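(* Let $ABC$ be a triangle and let $AD$, $BE$, $CF$ be the cevians through its Gergonne point, with $D$ on side $BC$, $E$ on side $CA$, $F$ on side $AB$. Let $r_1$ be the radius of the excircle of $\triangle ABD$ that touches side $BD$, $r_2$ the radius of the excircle of $\triangle ACD$ that touches side $DC$, $r_3$ the radius of the excircle of $\triangle BCE$ that touches side $CE$, $r_4$ the radius of the excircle of $\triangle BAE$ that touches side $EA$, $r_5$ the radius of the excircle of $\triangle CAF$ that touches side $AF$, and $r_6$ the radius of the excircle of $\triangle CBF$ that touches side $FB$. Then $$r_1r_3r_5=r_2r_4r_6.$$
   Context: If the incircle of $\triangle ABC$ touches the sides $BC$, $CA$, $AB$ at $D$, $E$, $F$ respectively, then $AD$, $BE$, $CF$ are concurrent, and their common point is the Gergonne point of $\triangle ABC$; so $D,E,F$ in the claim are these contact points. The excircle of a triangle that touches a given side is the circle tangent to that side (segment) and to the extensions of the other two sides, lying on the opposite side of that segment from the remaining vertex. *)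

theory Defs
  imports "HOL-Analysis.Analysis"
begin

type_synonym point = "real ^ 2"

definition circle_touches_line_at :: "point \<Rightarrow> real \<Rightarrow> point \<Rightarrow> point \<Rightarrow> point \<Rightarrow> bool" where
  "circle_touches_line_at J r P Q T \<longleftrightarrow>
     r > 0 \<and> P \<noteq> Q \<and> sphere J r \<inter> affine hull {P, Q} = {T}"

text \<open>The points of contact are required to lie on the sides themselves, which distinguishes
  the incircle from the three excircles.\<close>

definition incircle_touches_at ::
  "point \<Rightarrow> real \<Rightarrow> point \<Rightarrow> point \<Rightarrow> point \<Rightarrow> point \<Rightarrow> point \<Rightarrow> point \<Rightarrow> bool" where
  "incircle_touches_at J r A B C X Y Z \<longleftrightarrow>
     circle_touches_line_at J r B C X \<and> X \<in> closed_segment B C \<and>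
     circle_touches_line_at J r C A Y \<and> Y \<in> closed_segment C A \<and>
     circle_touches_line_at J r A B Z \<and> Z \<in> closed_segment A B"

definition is_gergonne_point :: "point \<Rightarrow> point \<Rightarrow> point \<Rightarrow> point \<Rightarrow> bool" where
  "is_gergonne_point A B C G \<longleftrightarrow>
     (\<exists>J r X Y Z. incircle_touches_at J r A B C X Y Z \<and>
        G \<in> closed_segment A X \<and> G \<in> closed_segment B Y \<and> G \<in> closed_segment C Z)"

text \<open>\<open>is_excircle J r P Q R\<close>: the circle with centre \<open>J\<close> and radius \<open>r\<close> is the excircle of the
  triangle \<open>PQR\<close> that touches the side \<open>QR\<close>. The extension of a side is its line without the
  side; the last conjunct says that the line \<open>QR\<close> separates the circle from \<open>P\<close>.\<close>

definition is_excircle :: "point \<Rightarrow> real \<Rightarrow> point \<Rightarrow> point \<Rightarrow> point \<Rightarrow> bool" where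
  "is_excircle J r P Q R \<longleftrightarrow>
     (\<exists>T. circle_touches_line_at J r Q R T \<and> T \<in> closed_segment Q R) \<and>
     (\<exists>U. circle_touches_line_at J r P Q U \<and> U \<notin> closed_segment P Q) \<and>
     (\<exists>V. circle_touches_line_at J r P R V \<and> V \<notin> closed_segment P R) \<and>
     (\<forall>S\<in>sphere J r. closed_segment P S \<inter> affine hull {Q, R} \<noteq> {})"

definition is_exradius :: "real \<Rightarrow> point \<Rightarrow> point \<Rightarrow> point \<Rightarrow> bool" where
  "is_exradius r P Q R \<longleftrightarrow> (\<exists>J. is_excircle J r P Q R)"

end

theory Submission
  imports Defs
begin

text \<open>The excircle of \<open>PQR\<close> opposite \<open>P\<close> has radius \<open>2 area / (PQ + PR - QR)\<close>. When \<open>D\<close> is the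
  contact point of the incircle on \<open>BC\<close>, equality of tangent lengths gives \<open>AB - BD = AC - DC\<close>, so
  the denominators for \<open>ABD\<close> and \<open>ADC\<close> agree and \<open>r1 / r2\<close> is the ratio of the areas, that is
  \<open>BD / DC\<close>. The product of the three such ratios is \<open>1\<close>, again by equality of tangent lengths.\<close>

section \<open>Planar cross product\<close>

text \<open>Twice the signed area of the triangle with vertices \<open>0\<close>, \<open>x\<close>,
  \<open>y\<close>.\<close>

definition cross2 :: "point \<Rightarrow> point \<Rightarrow> real" where
  "cross2 x y = x $ 1 * y $ 2 - x $ 2 * y $ 1"

lemma inner_point: "x \<bullet> y = x $ 1 * y $ 1 + x $ 2 * y $ 2" for x y :: point
  by (simp add: inner_vec_def sum_2)

lemma cross2_add_left: "cross2 (x + y) z = cross2 x z + cross2 y z"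
  and cross2_scale_left: "cross2 (c *\<^sub>R x) y = c * cross2 x y"
  and cross2_self: "cross2 x x = 0"
  by (simp_all add: cross2_def algebra_simps)

lemma lagrange_cross2: "(x \<bullet> y)\<^sup>2 + (cross2 x y)\<^sup>2 = (norm x)\<^sup>2 * (norm y)\<^sup>2"
  unfolding power2_norm_eq_inner inner_point cross2_def by algebra

text \<open>For nonzero \<open>w\<close>, the vectors \<open>w\<close> and \<open>w\<close> turned
  by a right angle form an orthogonal frame. Up to the factor \<open>norm w\<close>, the coordinates
  of \<open>x\<close> in it are \<open>w \<bullet> x\<close> and \<open>cross2 w x\<close>, and the
  right side is the determinant of these coordinates.\<close>

lemma cross2_norm_sq: "cross2 x y * (norm w)\<^sup>2 = (w \<bullet> x) * cross2 w y - (w \<bullet> y) * cross2 w x"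
  unfolding power2_norm_eq_inner inner_point cross2_def by algebra

text \<open>By Lagrange's identity a vanishing cross product is the equality case of Cauchy-Schwarz,
  which means collinearity.\<close>

lemma cross2_neq_0:
  assumes "\<not> collinear {A, B, C}"
  shows "cross2 (B - A) (C - A) \<noteq> 0"
proof
  assume "cross2 (B - A) (C - A) = 0"
  then have "((B - A) \<bullet> (C - A))\<^sup>2 = (norm (B - A) * norm (C - A))\<^sup>2"
    using lagrange_cross2[of "B - A" "C - A"] by (simp add: power_mult_distrib)
  then have "\<bar>(B - A) \<bullet> (C - A)\<bar> = \<bar>norm (B - A) * norm (C - A)\<bar>"
    by (simp only: power2_eq_iff abs_eq_iff)
  then have "collinear {0, B - A, C - A}"
    by (simp add: norm_cauchy_schwarz_equal[symmetric])
  then have "collinear {B, A, C}"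
    by (subst collinear_3) simp
  then show False using assms by (simp add: insert_commute)
qed

section \<open>Tangent lines of a circle\<close>

lemma circle_touches_lineD:
  assumes "circle_touches_line_at J r P Q T"
  obtains u where "T = P + u *\<^sub>R (Q - P)" "(J - T) \<bullet> (Q - P) = 0" "norm (J - T) = r" "r > 0"
    "P \<noteq> Q"
proof -
  have r: "r > 0" and ne: "P \<noteq> Q" and T: "sphere J r \<inter> affine hull {P, Q} = {T}"
    using assms by (auto simp: circle_touches_line_at_def)
  have line: "affine hull {P, Q} = {P + s *\<^sub>R (Q - P) | s. True}"
    by (auto simp: affine_hull_2_alt)
  have "T \<in> sphere J r" and "T \<in> affine hull {P, Q}" using T by auto
  then obtain u where u: "T = P + u *\<^sub>R (Q - P)" and nT: "norm (J - T) = r"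
    unfolding line by (auto simp: dist_norm)
  \<comment> \<open>The reflection of \<open>T\<close> in the foot of the perpendicular from \<open>J\<close> is also on the circle and the line.\<close>
  define t where "t = 2 * ((J - T) \<bullet> (Q - P)) / (norm (Q - P))\<^sup>2"
  define T' where "T' = T + t *\<^sub>R (Q - P)"
  have "(norm (J - T'))\<^sup>2 = (norm (J - T))\<^sup>2 - t * (2 * ((J - T) \<bullet> (Q - P)) - t * (norm (Q - P))\<^sup>2)"
    unfolding T'_def power2_norm_eq_inner
    by (simp add: inner_simps inner_commute algebra_simps)
  also have "\<dots> = (norm (J - T))\<^sup>2" using ne by (simp add: t_def)
  finally have "norm (J - T') = norm (J - T)" by (simp only: power2_eq_iff_nonneg norm_ge_zero)
  then have "norm (J - T') = r" using nT by simp
  moreover have "T' = P + (u + t) *\<^sub>R (Q - P)"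
    unfolding T'_def u by (simp add: algebra_simps)
  ultimately have "T' \<in> sphere J r \<inter> affine hull {P, Q}"
    unfolding line by (auto simp: dist_norm)
  then have "t *\<^sub>R (Q - P) = 0" using T unfolding T'_def by simp
  then have "(J - T) \<bullet> (Q - P) = 0" using ne by (simp add: t_def)
  with u nT r ne show ?thesis using that by blast
qed

lemma circle_touches_line_commute:
  "circle_touches_line_at J r P Q T \<longleftrightarrow> circle_touches_line_at J r Q P T"
  by (auto simp: circle_touches_line_at_def insert_commute)

text \<open>Pythagoras in the triangle \<open>P T J\<close>, right-angled at \<open>T\<close>. The
  right side depends only on the circle and \<open>P\<close>, so all tangents from \<open>P\<close>
  have equal length.\<close>

lemma tangent_length:
  assumes "circle_touches_line_at J r P Q T"
  shows "(dist P T)\<^sup>2 = (dist J P)\<^sup>2 - r\<^sup>2"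
proof -
  obtain u where u: "T = P + u *\<^sub>R (Q - P)" and orth: "(J - T) \<bullet> (Q - P) = 0"
    and r: "norm (J - T) = r"
    using circle_touches_lineD[OF assms] by blast
  have TP: "T - P = u *\<^sub>R (Q - P)" by (simp add: u)
  have "(J - T) \<bullet> (T - P) = 0" unfolding TP using orth by simp
  moreover have "J - P = (J - T) + (T - P)" by simp
  ultimately have "(norm (J - P))\<^sup>2 = (norm (J - T))\<^sup>2 + (norm (T - P))\<^sup>2"
    using norm_add_Pythagorean[of "J - T" "T - P"] by (simp add: orthogonal_def)
  then show ?thesis using r by (simp add: dist_norm norm_minus_commute)
qed

lemma tangent_lengths_eq:
  assumes "circle_touches_line_at J r P Q T" and "circle_touches_line_at J r P R V"
  shows "dist P T = dist P V"
  using tangent_length[OF assms(1)] tangent_length[OF assms(2)]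
  by (metis power2_eq_iff_nonneg zero_le_dist)

text \<open>Both sides are twice the area of the triangle \<open>J P Q\<close>, whose height over
  \<open>P Q\<close> is \<open>r\<close>: replacing \<open>P\<close> by \<open>T\<close> in
  \<open>J - P\<close> changes it only by a multiple of \<open>Q - P\<close>.\<close>

lemma abs_cross2_tangent:
  assumes "circle_touches_line_at J r P Q T"
  shows "\<bar>cross2 (J - P) (Q - P)\<bar> = r * dist P Q"
proof -
  obtain u where u: "T = P + u *\<^sub>R (Q - P)" and orth: "(J - T) \<bullet> (Q - P) = 0"
    and r: "norm (J - T) = r" "r > 0"
    using circle_touches_lineD[OF assms] by blast
  have "J - P = (J - T) + u *\<^sub>R (Q - P)" by (simp add: u)
  then have "cross2 (J - P) (Q - P) = cross2 (J - T) (Q - P)"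
    by (metis add.right_neutral cross2_add_left cross2_scale_left cross2_self mult_zero_right)
  then have "(cross2 (J - P) (Q - P))\<^sup>2 = (r * dist P Q)\<^sup>2"
    using lagrange_cross2[of "J - T" "Q - P"] orth r
    by (simp add: power_mult_distrib dist_norm norm_minus_commute)
  then have "\<bar>cross2 (J - P) (Q - P)\<bar> = \<bar>r * dist P Q\<bar>"
    by (simp only: power2_eq_iff abs_eq_iff)
  then show ?thesis using r(2) by (simp add: abs_mult)
qed

section \<open>Radius of an excircle\<close>

lemma outside_segment_dist:
  fixes P Q U :: point
  assumes "U = P + u *\<^sub>R (Q - P)" and "U \<notin> closed_segment P Q"
  shows "(u > 1 \<and> dist P U = dist P Q + dist Q U) \<or> (u < 0 \<and> dist Q U = dist P Q + dist P U)"
proof -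
  have "u < 0 \<or> u > 1"
  proof (rule ccontr)
    assume "\<not> ?thesis"
    then have "U \<in> closed_segment P Q"
      unfolding in_segment assms(1) by (intro exI[of _ u]) (auto simp: algebra_simps)
    with assms(2) show False ..
  qed
  moreover have "dist P U = \<bar>u\<bar> * dist P Q"
    by (simp add: assms(1) dist_norm norm_minus_commute)
  moreover have "dist Q U = \<bar>1 - u\<bar> * dist P Q"
  proof -
    have "Q - U = (1 - u) *\<^sub>R (Q - P)" by (simp add: assms(1) algebra_simps)
    then show ?thesis by (simp add: dist_norm norm_minus_commute)
  qed
  ultimately show ?thesis by (auto simp: algebra_simps)
qed

text \<open>With \<open>t\<close> the length of the tangents from \<open>P\<close>, twice the area equals \<open>r (PQ + PR \<plusminus> QR)\<close> and also
  \<open>2 t r \<cdot> PQ \<cdot> PR / (t\<^sup>2 + r\<^sup>2)\<close>; the plus sign would force \<open>t\<^sup>2 + r\<^sup>2 = PQ \<cdot> PR\<close>, impossible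
  because \<open>t\<close> exceeds both \<open>PQ\<close> and \<open>PR\<close>.\<close>

lemma exradius_formula:
  assumes nc: "cross2 (Q - P) (R - P) \<noteq> 0" and "is_exradius r P Q R"
  shows "r * (dist P Q + dist P R - dist Q R) = \<bar>cross2 (Q - P) (R - P)\<bar>"
proof -
  obtain J T U V where
    T: "circle_touches_line_at J r Q R T" "T \<in> closed_segment Q R" and
    U: "circle_touches_line_at J r P Q U" "U \<notin> closed_segment P Q" and
    V: "circle_touches_line_at J r P R V" "V \<notin> closed_segment P R"
    using assms(2) unfolding is_exradius_def is_excircle_def by blast
  obtain u where u: "U = P + u *\<^sub>R (Q - P)" "(J - U) \<bullet> (Q - P) = 0" "r > 0" "P \<noteq> Q"
    using circle_touches_lineD[OF U(1)] by blast
  obtain v where v: "V = P + v *\<^sub>R (R - P)" "(J - V) \<bullet> (R - P) = 0" "P \<noteq> R"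
    using circle_touches_lineD[OF V(1)] by blast
  have QR: "Q \<noteq> R" using T(1) by (simp add: circle_touches_line_at_def)
  define p q where "p = dist P Q" and "q = dist P R"
  have pos: "p > 0" "q > 0" using u v by (auto simp: p_def q_def)
  define t where "t = dist P U"
  have PV: "dist P V = t" unfolding t_def using tangent_lengths_eq[OF V(1) U(1)] .
  have QT: "dist Q U = dist Q T"
    using tangent_lengths_eq U(1) T(1) circle_touches_line_commute by blast
  have RT: "dist R V = dist R T"
    using tangent_lengths_eq V(1) T(1) circle_touches_line_commute by blast
  have seg: "dist Q R = dist Q T + dist R T"
    using T(2) by (metis between between_mem_segment dist_commute)
  \<comment> \<open>Strictness comes from \<open>nc\<close>: equality would put \<open>P\<close> on
    the segment \<open>Q R\<close>.\<close>
  have tri: "dist Q R < p + q"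
  proof (rule ccontr)
    assume "\<not> dist Q R < p + q"
    then have "dist Q R = p + q"
      using dist_triangle[of Q R P] by (simp add: p_def q_def dist_commute)
    then have "P \<in> closed_segment Q R"
      by (metis between between_mem_segment dist_commute p_def q_def)
    then obtain s where s: "P = (1 - s) *\<^sub>R Q + s *\<^sub>R R" by (auto simp: in_segment)
    have "cross2 (Q - P) (R - P) = 0"
      unfolding s cross2_def by (simp add: algebra_simps)
    with nc show False ..
  qed
  have uc: "(u > 1 \<and> t = p + dist Q T) \<or> (u < 0 \<and> dist Q T = p + t)"
    using outside_segment_dist[OF u(1) U(2)] QT by (simp add: t_def p_def)
  have vc: "(v > 1 \<and> t = q + dist R T) \<or> (v < 0 \<and> dist R T = q + t)"
    using outside_segment_dist[OF v(1) V(2)] RT PV by (simp add: q_def)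
  have nn: "t \<ge> 0" "dist Q T \<ge> 0" "dist R T \<ge> 0" by (auto simp: t_def)
  \<comment> \<open>If \<open>U\<close> or \<open>V\<close> lay on the far side of \<open>P\<close>,
    adding the two lengths would give \<open>dist Q R \<ge> p + q\<close>, against
    \<open>tri\<close>. So \<open>U\<close> lies beyond \<open>Q\<close> and \<open>V\<close> beyond
    \<open>R\<close>.\<close>
  have u1: "u > 1" and v1: "v > 1" and tp: "t = p + dist Q T" and tq: "t = q + dist R T"
    using uc vc nn seg tri pos by linarith+
  have up: "t = u * p" using u1
    by (simp add: t_def p_def u(1) dist_norm norm_minus_commute)
  have vq: "t = v * q" using v1 PV
    by (simp add: q_def v(1) dist_norm norm_minus_commute)
  have tgt: "t > p" "t > q" using up u1 pos(1) vq v1 pos(2) mult_strict_right_mono[of 1] by fastforce+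
  define w where "w = J - P"
  define K where "K = cross2 (Q - P) (R - P)"
  \<comment> \<open>\<open>U\<close> is the foot of the perpendicular from \<open>J\<close>, so only
    the component of \<open>w\<close> along \<open>Q - P\<close> contributes.\<close>
  have wQ: "w \<bullet> (Q - P) = t * p"
  proof -
    have "w = (J - U) + u *\<^sub>R (Q - P)" by (simp add: w_def u(1))
    then have "w \<bullet> (Q - P) = (J - U) \<bullet> (Q - P) + u * ((Q - P) \<bullet> (Q - P))"
      by (metis inner_add_left inner_scaleR_left)
    then have "w \<bullet> (Q - P) = u * p\<^sup>2"
      using u(2) by (simp add: p_def dist_norm norm_minus_commute[of P] power2_norm_eq_inner)
    then show ?thesis by (simp add: up power2_eq_square)
  qed
  have wR: "w \<bullet> (R - P) = t * q"
  proof -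
    have "w = (J - V) + v *\<^sub>R (R - P)" by (simp add: w_def v(1))
    then have "w \<bullet> (R - P) = (J - V) \<bullet> (R - P) + v * ((R - P) \<bullet> (R - P))"
      by (metis inner_add_left inner_scaleR_left)
    then have "w \<bullet> (R - P) = v * q\<^sup>2"
      using v(2) by (simp add: q_def dist_norm norm_minus_commute[of P] power2_norm_eq_inner)
    then show ?thesis by (simp add: vq power2_eq_square)
  qed
  have nw: "(norm w)\<^sup>2 = t\<^sup>2 + r\<^sup>2"
    using tangent_length[OF U(1)] by (simp add: t_def w_def dist_norm norm_minus_commute)
  have cQ: "\<bar>cross2 w (Q - P)\<bar> = r * p"
    using abs_cross2_tangent[OF U(1)] by (simp add: w_def p_def)
  have cR: "\<bar>cross2 w (R - P)\<bar> = r * q"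
    using abs_cross2_tangent[OF V(1)] by (simp add: w_def q_def)
  have cT: "\<bar>cross2 (J - Q) (R - Q)\<bar> = r * dist Q R"
    using abs_cross2_tangent[OF T(1)] .
  \<comment> \<open>The signed area of \<open>P Q R\<close> is split into those of the triangles
    with apex \<open>J\<close> over its sides.\<close>
  have Ksum: "cross2 w (R - P) - cross2 w (Q - P) - cross2 (J - Q) (R - Q) = K"
    unfolding w_def K_def cross2_def by (simp add: algebra_simps)
  have Kw: "K * (t\<^sup>2 + r\<^sup>2) = t * p * cross2 w (R - P) - t * q * cross2 w (Q - P)"
    using cross2_norm_sq[of "Q - P" "R - P" w] unfolding nw wQ wR K_def .
  have K0: "K \<noteq> 0" using nc by (simp add: K_def)
  have tr: "t\<^sup>2 + r\<^sup>2 > 0" using u(3) by (simp add: add_nonneg_pos)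
  \<comment> \<open>Equal signs of the two cross products would make the right side of
    \<open>Kw\<close> vanish. With opposite signs, a single signed radius \<open>\<rho>\<close>
    describes both.\<close>
  obtain \<rho> where \<rho>: "\<bar>\<rho>\<bar> = r" "cross2 w (R - P) = \<rho> * q" "cross2 w (Q - P) = - \<rho> * p"
  proof -
    have "cross2 w (R - P) = r * q \<or> cross2 w (R - P) = - r * q" using cR by (auto simp: abs_if split: if_splits)
    moreover have "cross2 w (Q - P) = r * p \<or> cross2 w (Q - P) = - r * p" using cQ by (auto simp: abs_if split: if_splits)
    moreover have "\<not> (cross2 w (R - P) = s * q \<and> cross2 w (Q - P) = s * p)" for s
    proof
      assume "cross2 w (R - P) = s * q \<and> cross2 w (Q - P) = s * p"
      then have "K * (t\<^sup>2 + r\<^sup>2) = 0" using Kw by simp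
      with K0 tr show False by simp
    qed
    ultimately show ?thesis using that[of r] that[of "- r"] u(3)
      by (metis abs_minus_cancel abs_of_pos minus_minus)
  qed
  have \<rho>0: "\<rho> \<noteq> 0" using \<rho>(1) u(3) by auto
  have cT': "cross2 (J - Q) (R - Q) = \<rho> * dist Q R \<or> cross2 (J - Q) (R - Q) = - \<rho> * dist Q R"
    using cT \<rho>(1) by (auto simp: abs_if split: if_splits)
  have "K = \<rho> * (p + q - dist Q R)"
  proof (rule ccontr)
    assume "\<not> ?thesis"
    then have "K = \<rho> * (p + q + dist Q R)"
      using cT' Ksum \<rho> by (auto simp: algebra_simps)
    \<comment> \<open>The perimeter of \<open>P Q R\<close> is \<open>2 * t\<close>, the sum of
      \<open>tp\<close> and \<open>tq\<close>.\<close>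
    then have "K = \<rho> * (2 * t)" using tp tq seg by simp
    moreover have "K * (t\<^sup>2 + r\<^sup>2) = \<rho> * (2 * t) * (p * q)"
      using Kw \<rho> by (simp add: algebra_simps)
    ultimately have "t\<^sup>2 + r\<^sup>2 = p * q" using K0 by (metis mult_cancel_left)
    moreover have "p * q < t * t" using tgt pos by (intro mult_strict_mono) auto
    ultimately show False using zero_le_square[of r] unfolding power2_eq_square by linarith
  qed
  then show ?thesis
    using \<rho>(1) tri unfolding K_def p_def q_def by (simp add: abs_mult)
qed

section \<open>Contact points and cevians through the Gergonne point\<close>

lemma incircle_rotate:
  "incircle_touches_at J r A B C X Y Z \<Longrightarrow> incircle_touches_at J r B C A Y Z X"
  by (auto simp: incircle_touches_at_def)

lemma not_collinear_rotate: "\<not> collinear {A, B, C} \<Longrightarrow> \<not> collinear {B, C, A}"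
  by (simp add: insert_commute)

text \<open>Equal tangent lengths from \<open>A\<close> make \<open>Y = A\<close> equivalent to
  \<open>Z = A\<close>. If both held, the nonzero vector \<open>J - A\<close> would be perpendicular
  to both sides at \<open>A\<close>, which would then be parallel.\<close>

lemma contact_points_not_vertex:
  assumes nc: "\<not> collinear {A, B, C}" and inc: "incircle_touches_at J r A B C X Y Z"
  shows "Y \<noteq> A" "Z \<noteq> A"
proof -
  have CA: "circle_touches_line_at J r A C Y" and AB: "circle_touches_line_at J r A B Z"
    using inc circle_touches_line_commute unfolding incircle_touches_at_def by blast+
  have "dist A Y = dist A Z" using tangent_lengths_eq[OF CA AB] .
  moreover have "\<not> (Y = A \<and> Z = A)"
  proof
    assume "Y = A \<and> Z = A"
    then have "(J - A) \<bullet> (C - A) = 0" "(J - A) \<bullet> (B - A) = 0" "norm (J - A) > 0"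
      using circle_touches_lineD[OF CA] circle_touches_lineD[OF AB] by metis+
    then show False
      using cross2_norm_sq[of "B - A" "C - A" "J - A"] cross2_neq_0[OF nc] by simp
  qed
  ultimately show "Y \<noteq> A" "Z \<noteq> A" by (metis dist_eq_0_iff)+
qed

text \<open>All points \<open>S\<close> of \<open>B C\<close> give the same
  \<open>cross2 (S - A) (C - B)\<close>, since they differ by multiples of \<open>C - B\<close>.
  Hence \<open>G\<close> alone determines the factor \<open>g\<close> in
  \<open>G - A = g *\<^sub>R (S - A)\<close>, and as \<open>G \<noteq> A\<close> makes
  \<open>g\<close> nonzero, also \<open>S\<close>.\<close>

lemma cevian_foot_unique:
  fixes A B C D X G :: point
  assumes nc: "\<not> collinear {A, B, C}"
    and D: "D \<in> closed_segment B C" "G \<in> closed_segment A D"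
    and X: "X \<in> closed_segment B C" "G \<in> closed_segment A X"
    and "G \<noteq> A"
  shows "D = X"
proof -
  have param: "\<exists>g. G - A = g *\<^sub>R (S - A) \<and> cross2 (S - A) (C - B) = cross2 (B - A) (C - A)"
    if S: "S \<in> closed_segment B C" "G \<in> closed_segment A S" for S
  proof -
    obtain d where d: "S = (1 - d) *\<^sub>R B + d *\<^sub>R C" using S(1) by (auto simp: in_segment)
    have "cross2 (S - A) (C - B) = cross2 (B - A) (C - A)"
      unfolding d cross2_def by (simp add: algebra_simps)
    moreover obtain g where "G = (1 - g) *\<^sub>R A + g *\<^sub>R S" using S(2) by (auto simp: in_segment)
    then have "G - A = g *\<^sub>R (S - A)" by (simp add: algebra_simps)
    ultimately show ?thesis by blast
  qed
  obtain g h where g: "G - A = g *\<^sub>R (D - A)" and h: "G - A = h *\<^sub>R (X - A)"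
    and cr: "cross2 (D - A) (C - B) = cross2 (B - A) (C - A)"
      "cross2 (X - A) (C - B) = cross2 (B - A) (C - A)"
    using param[OF D] param[OF X] by blast
  have "g * cross2 (B - A) (C - A) = h * cross2 (B - A) (C - A)"
    using g h cr cross2_scale_left by metis
  then have "g = h" using cross2_neq_0[OF nc] by simp
  moreover have "g \<noteq> 0" using g \<open>G \<noteq> A\<close> by auto
  ultimately show ?thesis using g h by simp
qed

lemma gergonne_cevian_foot:
  assumes nc: "\<not> collinear {A, B, C}" and inc: "incircle_touches_at J r A B C X Y Z"
    and G: "G \<in> closed_segment A X" "G \<in> closed_segment B Y"
    and D: "D \<in> closed_segment B C" "G \<in> closed_segment A D"
  shows "D = X"
proof -
  have X: "X \<in> closed_segment B C" and Y: "Y \<in> closed_segment C A"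
    using inc by (auto simp: incircle_touches_at_def)
  have "G \<noteq> A"
  proof
    assume "G = A"
    moreover have "A \<noteq> B" using nc by auto
    \<comment> \<open>With \<open>G = A\<close>, the vertex \<open>A\<close> is itself a foot on
      \<open>C A\<close> of a cevian from \<open>B\<close> through \<open>G\<close>, so it coincides
      with the foot \<open>Y\<close>.\<close>
    ultimately have "Y = A"
      using cevian_foot_unique[OF not_collinear_rotate[OF nc] Y, of G A] G(2) by auto
    then show False using contact_points_not_vertex[OF nc inc] by simp
  qed
  then show ?thesis using cevian_foot_unique[OF nc D X G(1)] by simp
qed

section \<open>Ratio of the two exradii at a cevian, and the product\<close>

lemma exradii_ratio:
  assumes nc: "\<not> collinear {A, B, C}" and inc: "incircle_touches_at J r A B C X Y Z"
    and ex: "is_exradius r1 A B X" "is_exradius r2 A X C"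
  shows "r1 * dist C X = r2 * dist B X"
proof -
  have BC: "circle_touches_line_at J r B C X" "X \<in> closed_segment B C"
    and CA: "circle_touches_line_at J r C A Y" "Y \<in> closed_segment C A"
    and AB: "circle_touches_line_at J r A B Z" "Z \<in> closed_segment A B"
    using inc by (auto simp: incircle_touches_at_def)
  \<comment> \<open>The excircles exist only for sides with distinct endpoints, so \<open>X\<close>
    is neither \<open>B\<close> nor \<open>C\<close>.\<close>
  have ne: "B \<noteq> X" "X \<noteq> C" "A \<noteq> X"
    using ex by (auto simp: is_exradius_def is_excircle_def circle_touches_line_at_def)
  have tan: "dist A Y = dist A Z" "dist B X = dist B Z" "dist C X = dist C Y"
    using tangent_lengths_eq BC(1) CA(1) AB(1) circle_touches_line_commute by blast+
  have sides: "dist A B = dist A Z + dist B Z" "dist A C = dist A Y + dist C Y"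
    using AB(2) CA(2) by (metis between between_mem_segment dist_commute add.commute)+
  obtain d where d: "0 \<le> d" "d \<le> 1" "X = (1 - d) *\<^sub>R B + d *\<^sub>R C"
    using BC(2) by (auto simp: in_segment)
  have d01: "d \<noteq> 0" "1 - d \<noteq> 0" using ne d(3) by auto
  define K where "K = cross2 (B - A) (C - A)"
  have K0: "K \<noteq> 0" using cross2_neq_0[OF nc] by (simp add: K_def)
  \<comment> \<open>The cevian divides the area in the ratio \<open>d\<close> to
    \<open>1 - d\<close>, the same in which \<open>X\<close> divides \<open>B C\<close>.\<close>
  have K1: "cross2 (B - A) (X - A) = d * K" and K2: "cross2 (X - A) (C - A) = (1 - d) * K"
    unfolding K_def d(3) cross2_def by (simp_all add: algebra_simps)
  define a where "a = dist B C"
  have "X - B = d *\<^sub>R (C - B)" "X - C = (1 - d) *\<^sub>R (B - C)" using d(3) by (simp_all add: algebra_simps)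
  then have BX: "dist B X = d * a" and CX: "dist C X = (1 - d) * a"
    using d(1,2) unfolding a_def dist_norm by (metis norm_minus_commute norm_scaleR abs_of_nonneg diff_ge_0_iff_ge)+
  have den: "dist A B + dist A X - dist B X = dist A X + dist A Z"
    "dist A X + dist A C - dist X C = dist A X + dist A Z"
    using sides tan by (simp_all add: dist_commute[of X C])
  have "cross2 (B - A) (X - A) \<noteq> 0" "cross2 (X - A) (C - A) \<noteq> 0"
    unfolding K1 K2 using K0 d01 by auto
  note exradius_formula[OF this(1) ex(1), unfolded den K1]
    exradius_formula[OF this(2) ex(2), unfolded den K2]
  then have e1: "r1 * (dist A X + dist A Z) = d * \<bar>K\<bar>"
    and e2: "r2 * (dist A X + dist A Z) = (1 - d) * \<bar>K\<bar>"
    using d(1,2) by (simp_all add: abs_mult)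
  have "(r1 * dist C X) * (dist A X + dist A Z) = (r2 * dist B X) * (dist A X + dist A Z)"
    using e1 e2 unfolding BX CX by algebra
  moreover have "dist A X + dist A Z > 0" using ne by (simp add: add_pos_nonneg)
  ultimately show ?thesis by simp
qed

theorem theorem4p1:
  fixes A B C D E F G :: point
    and r1 r2 r3 r4 r5 r6 :: real
  assumes "\<not> collinear {A, B, C}"
    and "is_gergonne_point A B C G"
    and "D \<in> closed_segment B C" and "G \<in> closed_segment A D"
    and "E \<in> closed_segment C A" and "G \<in> closed_segment B E"
    and "F \<in> closed_segment A B" and "G \<in> closed_segment C F"
    and "is_exradius r1 A B D"
    and "is_exradius r2 A D C"
    and "is_exradius r3 B C E"
    and "is_exradius r4 B E A"
    and "is_exradius r5 C A F"
    and "is_exradius r6 C F B"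
  shows "r1 * r3 * r5 = r2 * r4 * r6"
proof -
  obtain J r X Y Z where inc1: "incircle_touches_at J r A B C X Y Z"
    and G: "G \<in> closed_segment A X" "G \<in> closed_segment B Y" "G \<in> closed_segment C Z"
    using assms(2) by (auto simp: is_gergonne_point_def)
  note inc2 = incircle_rotate[OF inc1]
  note inc3 = incircle_rotate[OF inc2]
  note nc1 = assms(1)
  note nc2 = not_collinear_rotate[OF nc1]
  note nc3 = not_collinear_rotate[OF nc2]
  have feet: "D = X" "E = Y" "F = Z"
    using gergonne_cevian_foot[OF nc1 inc1 G(1,2) assms(3,4)]
      gergonne_cevian_foot[OF nc2 inc2 G(2,3) assms(5,6)]
      gergonne_cevian_foot[OF nc3 inc3 G(3,1) assms(7,8)] by auto
  have touch: "circle_touches_line_at J r B C X" "circle_touches_line_at J r C A Y"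
    "circle_touches_line_at J r A B Z"
    using inc1 by (auto simp: incircle_touches_at_def)
  \<comment> \<open>The tangent lengths of the incircle from \<open>A\<close>, \<open>B\<close> and
    \<open>C\<close>.\<close>
  define x y z where "x = dist A Z" and "y = dist B X" and "z = dist C Y"
  have tan: "dist A Y = x" "dist B Z = y" "dist C X = z"
    unfolding x_def y_def z_def
    using tangent_lengths_eq touch circle_touches_line_commute by blast+
  have "r1 * z = r2 * y" "r3 * x = r4 * z" "r5 * y = r6 * x"
    using exradii_ratio[OF nc1 inc1] exradii_ratio[OF nc2 inc2] exradii_ratio[OF nc3 inc3]
      assms(9-14) tan
    unfolding feet x_def y_def z_def by auto
  \<comment> \<open>Multiplying the three relations puts the same factor \<open>x * y * z\<close> on
    both sides; it is nonzero because no contact point is a vertex.\<close>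
  then have "(r1 * r3 * r5) * (x * y * z) = (r2 * r4 * r6) * (x * y * z)" by algebra
  moreover have "x * y * z \<noteq> 0"
    using contact_points_not_vertex(2)[OF nc1 inc1] contact_points_not_vertex(2)[OF nc2 inc2]
      contact_points_not_vertex(2)[OF nc3 inc3]
    by (auto simp: x_def y_def z_def)
  ultimately show ?thesis by simp
qed

end
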